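(* Let $\sigma$ be a module ordering on $\mathbb{T}^n\langle e_1,\dots,e_r\rangle$ and let $\overline\sigma$ be its extension by $W$. Let $v_1,\dots,v_s$ be vectors in $F$ and let $U\in\overline F$ be a homogeneous non-zero vector. (1) There exist $r_1,\dots,r_m\in\mathbb{N}$ such that $\mathrm{LT}_{\overline\sigma}(U)=y_1^{r_1}\cdots y_m^{r_m}\cdot\mathrm{LT}_{\overline\sigma}(U^{\rm sat})$. (2) Comparing (1) with the formula $\mathrm{LT}_{\overline\sigma}(U)=y_1^{s_1}\cdots y_m^{s_m}\cdot\mathrm{LT}_\sigma(U^{\rm deh})$ (which holds for suitable $s_1,\dots,s_m\in\mathbb{N}$), we have $r_i\le s_i$ for $i=1,\dots,m$. (3) We have $(\mathrm{LT}_{\overline\sigma}(U))^{\rm sat}=\mathrm{LT}_\sigma(U^{\rm deh})$. (4) If $N$ is a graded submodule of $\overline F$, then $N^{\rm sat}=N:_{\overline F}(y_1\cdots y_m)^\infty$. (5) If $N$ is a graded submodule of $\overline F$, then $N^{\rm sat}=\langle V^{\rm sat}\mid V\in N,\ V\text{ homogeneous}\rangle$. (6) If $N$ is a graded submodule of $\overline F$, then $(N^{\rm sat})^{\rm deh}=N^{\rm deh}$. (7) If $M=\langle v_1,\dots,v_s\rangle$ is a submodule of $F$, then $M^{\rm hom}=\langle v_1^{\rm hom},\dots,v_s^{\rm hom}\rangle^{\rm sat}$.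
   Context: Setting. $K$ is a field, $P=K[x_1,\dots,x_n]$, $W\in\mathrm{Mat}_{m,n}(\mathbb{Z})$ is a matrix of rank $m\ge 1$, and $\overline{P}=K[y_1,\dots,y_m,x_1,\dots,x_n]$ is graded by $\overline{W}=(I_m\mid W)$, i.e. $\deg_{\overline W}(y_i)$ is the $i$-th standard basis vector of $\mathbb{Z}^m$ and $\deg_{\overline W}(x_j)$ is the $j$-th column of $W$. $\mathbb{T}^n$ is the monoid of power products of $P$. $F=P^r$ has canonical basis $e_1,\dots,e_r$; $\delta_1,\dots,\delta_r\in\mathbb{Z}^m$ are fixed and $\overline{F}=\bigoplus_{i=1}^r\overline{P}(-\delta_i)$, so $\deg(te_i)=\deg(t)+\delta_i$. $\mathbb{T}^n\langle e_1,\dots,e_r\rangle$ is the set of terms $te_i$ of $F$. $\mathbb{Z}^m$ is ordered lexicographically. Orderings. A module ordering on a set of terms is a total ordering compatible with multiplication by power products and compatible with a monoid ordering $\tau$ on power products ($t_1>_\tau t_2$ implies $t_1e_i>t_2e_i$). The extension $\overline{\sigma}$ of $\sigma$ by $W$ to the terms of $\overline F$: $t_1e_i>_{\overline\sigma}t_2e_j$ iff $\deg_{\overline W}(t_1e_i)>\deg_{\overline W}(t_2e_j)$, or these degrees are equal and $t_1^{\rm deh}e_i>_\sigma t_2^{\rm deh}e_j$. LT is the leading term; terms of $F$ are also regarded as terms of $\overline F$. Homogenization. For $V\in\overline F$, $V^{\rm deh}\in F$ is obtained by setting $y_1=\dots=y_m=1$. For $0\ne v=\sum_j c_jt_je_{i_j}\in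 F$ (distinct terms, $c_j\neq0$), let $\mu\in\mathbb{Z}^m$ be the componentwise maximum of the $\deg_W(t_je_{i_j})$; then $v^{\rm hom}=\sum_j c_j\,y^{\mu-\deg_W(t_je_{i_j})}t_je_{i_j}\in\overline F$, and $0^{\rm hom}=0$. For a submodule $M\subseteq F$, $M^{\rm hom}=\langle v^{\rm hom}\mid v\in M\rangle\subseteq\overline F$; for a graded submodule $N\subseteq\overline F$, $N^{\rm deh}=\{V^{\rm deh}\mid V\in N\}$. For homogeneous $U\in\overline F$, $U^{\rm sat}=(U^{\rm deh})^{\rm hom}$, and for a graded submodule $N$, $N^{\rm sat}=(N^{\rm deh})^{\rm hom}$. $N:_{\overline F}(y_1\cdots y_m)^\infty=\{V\in\overline F\mid (y_1\cdots y_m)^aV\in N\text{ for some }a\in\mathbb{N}\}$. *)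

theory Defs
  imports
    "HOL-Analysis.Cartesian_Space"
    "HOL-Library.Poly_Mapping"
    "HOL-Library.Fun_Lexorder"
begin

text \<open>
  A power product is given by its exponents, so that the product of power products is \<open>+\<close> on
  \<open>'v pp\<close>. The indeterminates are indexed by a finite type: \<open>'n\<close> for the ring \<open>P\<close>, and
  \<open>'m + 'n\<close> for the ring \<open>P\<close>-bar, where \<open>Inl k\<close> stands for \<open>y\<^sub>k\<close> and \<open>Inr j\<close> for \<open>x\<^sub>j\<close>.
\<close>

type_synonym 'v pp = "'v \<Rightarrow>\<^sub>0 nat"
type_synonym ('v, 'k) mpol = "'v pp \<Rightarrow>\<^sub>0 'k"

definition indet :: "'v \<Rightarrow> ('v, 'k::field) mpol" where
  "indet x = Poly_Mapping.single (Poly_Mapping.single x 1) 1"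

definition subst_mpol :: "('v::finite \<Rightarrow> ('w, 'k::field) mpol) \<Rightarrow> ('v, 'k) mpol \<Rightarrow> ('w, 'k) mpol" where
  "subst_mpol f p =
     (\<Sum>t\<in>Poly_Mapping.keys p.
        Poly_Mapping.single 0 (Poly_Mapping.lookup p t) * (\<Prod>x\<in>UNIV. f x ^ Poly_Mapping.lookup t x))"

text \<open>
  \<open>subspace\<close> and \<open>span\<close> of this interpretation are the submodules of, and the submodule generated
  by a subset of, the free module \<open>R\<^sup>r\<close> over a commutative ring \<open>R\<close>.
\<close>

global_interpretation free_module: module "vector_scalar_mult :: 'a::comm_ring_1 \<Rightarrow> 'a ^ 'r \<Rightarrow> 'a ^ 'r"
  by unfold_locales (simp_all add: vec_eq_iff algebra_simps)

text \<open>
  The pair \<open>(t, i)\<close> represents the term \<open>t e\<^sub>i\<close>; the vector it denotes is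
  \<open>monom_vec 1 (t, i)\<close>.
\<close>

type_synonym ('v, 'r) mterm = "'v pp \<times> 'r"

definition monom_vec :: "'k::field \<Rightarrow> ('v, 'r::finite) mterm \<Rightarrow> ('v, 'k) mpol ^ 'r" where
  "monom_vec c = (\<lambda>(t, i). axis i (Poly_Mapping.single t c))"

definition coeff_vec :: "('v, 'k::field) mpol ^ 'r::finite \<Rightarrow> ('v, 'r) mterm \<Rightarrow> 'k" where
  "coeff_vec V = (\<lambda>(t, i). Poly_Mapping.lookup (V $ i) t)"

definition supp_vec :: "('v, 'k::field) mpol ^ 'r::finite \<Rightarrow> ('v, 'r) mterm set" where
  "supp_vec V = {u. coeff_vec V u \<noteq> 0}"

text \<open>
  An ordering is a reflexive relation; \<open>(a, b)\<close> in the relation means that \<open>a\<close> is at most \<open>b\<close>.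
  Monoid orderings need not be well-orderings, i.e. the power product 1 need not be the least one.
  Strict compatibility with multiplication follows, because multiplication is injective.
\<close>

definition monoid_ordering :: "'v pp rel \<Rightarrow> bool" where
  "monoid_ordering \<tau> \<longleftrightarrow> linear_order \<tau> \<and> (\<forall>t a b. (a, b) \<in> \<tau> \<longrightarrow> (t + a, t + b) \<in> \<tau>)"

definition module_ordering :: "('v, 'r) mterm rel \<Rightarrow> bool" where
  "module_ordering \<sigma> \<longleftrightarrow>
     linear_order \<sigma> \<and>
     (\<forall>t a i b j. ((a, i), (b, j)) \<in> \<sigma> \<longrightarrow> ((t + a, i), (t + b, j)) \<in> \<sigma>) \<and>
     (\<exists>\<tau>. monoid_ordering \<tau> \<and>
        (\<forall>a b i. (a, b) \<in> \<tau> \<and> a \<noteq> b \<longrightarrow> ((a, i), (b, i)) \<in> \<sigma>))"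

text \<open>The leading term as a vector; only meaningful for \<open>V \<noteq> 0\<close>.\<close>

definition LT :: "('v, 'r::finite) mterm rel \<Rightarrow> ('v, 'k::field) mpol ^ 'r \<Rightarrow> ('v, 'k) mpol ^ 'r" where
  "LT \<sigma> V = monom_vec 1 (THE u. u \<in> supp_vec V \<and> (\<forall>w\<in>supp_vec V. (w, u) \<in> \<sigma>))"

text \<open>
  Degree of the term \<open>t e\<^sub>i\<close> if the indeterminates have the columns of \<open>A\<close> as degrees and
  \<open>e\<^sub>i\<close> has degree \<open>\<delta> i\<close>.
\<close>

definition wdeg :: "int ^ 'v ^ 'm \<Rightarrow> ('r \<Rightarrow> int ^ 'm) \<Rightarrow> ('v::finite, 'r) mterm \<Rightarrow> int ^ 'm::finite" where
  "wdeg A \<delta> = (\<lambda>(t, i). A *v (\<chi> x. int (Poly_Mapping.lookup t x)) + \<delta> i)"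

text \<open>The matrix \<open>(I\<^sub>m | W)\<close>: \<open>y\<^sub>k\<close> has the \<open>k\<close>-th standard basis vector as its degree.\<close>

definition Wbar :: "int ^ 'n ^ 'm \<Rightarrow> int ^ ('m + 'n) ^ 'm::finite" where
  "Wbar W = (\<chi> k x. case x of Inl l \<Rightarrow> (if k = l then 1 else 0) | Inr j \<Rightarrow> W $ k $ j)"

definition homogeneous ::
  "int ^ 'v ^ 'm::finite \<Rightarrow> ('r \<Rightarrow> int ^ 'm) \<Rightarrow> ('v::finite, 'k::field) mpol ^ 'r::finite \<Rightarrow> bool" where
  "homogeneous A \<delta> V \<longleftrightarrow> (\<exists>d. \<forall>u\<in>supp_vec V. wdeg A \<delta> u = d)"

definition hom_component ::
  "int ^ 'v ^ 'm::finite \<Rightarrow> ('r \<Rightarrow> int ^ 'm) \<Rightarrow> int ^ 'm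
    \<Rightarrow> ('v::finite, 'k::field) mpol ^ 'r::finite \<Rightarrow> ('v, 'k) mpol ^ 'r" where
  "hom_component A \<delta> d V = (\<Sum>u | u \<in> supp_vec V \<and> wdeg A \<delta> u = d. monom_vec (coeff_vec V u) u)"

definition graded_submodule ::
  "int ^ 'v ^ 'm::finite \<Rightarrow> ('r \<Rightarrow> int ^ 'm) \<Rightarrow> (('v::finite, 'k::field) mpol ^ 'r::finite) set \<Rightarrow> bool" where
  "graded_submodule A \<delta> N \<longleftrightarrow>
     free_module.subspace N \<and> (\<forall>V\<in>N. \<forall>d. hom_component A \<delta> d V \<in> N)"

definition y_pow :: "('m::finite \<Rightarrow> nat) \<Rightarrow> ('m + 'n, 'k::field) mpol" where
  "y_pow a = (\<Prod>k\<in>UNIV. indet (Inl k) ^ a k)"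

text \<open>The embedding of \<open>F = P\<^sup>r\<close> into the corresponding module \<open>F\<close>-bar over \<open>P\<close>-bar.\<close>

definition incl :: "('n::finite, 'k::field) mpol ^ 'r::finite \<Rightarrow> ('m + 'n, 'k) mpol ^ 'r" where
  "incl v = (\<chi> i. subst_mpol (\<lambda>j. indet (Inr j)) (v $ i))"

definition deh :: "('m::finite + 'n::finite, 'k::field) mpol ^ 'r::finite \<Rightarrow> ('n, 'k) mpol ^ 'r" where
  "deh V = (\<chi> i. subst_mpol (case_sum (\<lambda>k. 1) indet) (V $ i))"

text \<open>
  Dehomogenization of terms. Since \<open>Inr\<close> is injective, \<open>map_key Inr t\<close> consists of the exponents
  of \<open>t\<close> in the indeterminates \<open>x\<^sub>j\<close>.
\<close>

definition deh_term :: "('m + 'n, 'r) mterm \<Rightarrow> ('n, 'r) mterm" where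
  "deh_term = (\<lambda>(t, i). (Poly_Mapping.map_key Inr t, i))"

text \<open>
  The extension of \<open>\<sigma>\<close> by \<open>W\<close>; \<open>less_fun\<close> is the strict lexicographic order.
\<close>

definition extend_ordering ::
  "int ^ 'n ^ 'm::{finite,linorder} \<Rightarrow> ('r \<Rightarrow> int ^ 'm::{finite,linorder}) \<Rightarrow> ('n::finite, 'r) mterm rel
    \<Rightarrow> ('m + 'n, 'r) mterm rel" where
  "extend_ordering W \<delta> \<sigma> =
     {(u, w). u = w
        \<or> less_fun (vec_nth (wdeg (Wbar W) \<delta> u)) (vec_nth (wdeg (Wbar W) \<delta> w))
        \<or> (wdeg (Wbar W) \<delta> u = wdeg (Wbar W) \<delta> w
            \<and> (deh_term u, deh_term w) \<in> \<sigma> \<and> deh_term u \<noteq> deh_term w)}"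

definition top_degree ::
  "int ^ 'n ^ 'm::finite \<Rightarrow> ('r \<Rightarrow> int ^ 'm) \<Rightarrow> ('n::finite, 'k::field) mpol ^ 'r::finite \<Rightarrow> int ^ 'm" where
  "top_degree W \<delta> v = (\<chi> k. Max ((\<lambda>u. wdeg W \<delta> u $ k) ` supp_vec v))"

text \<open>
  The arguments of \<open>nat\<close> are nonnegative by definition of \<open>top_degree\<close>; for \<open>v = 0\<close> the sum is
  empty, so \<open>homog W \<delta> 0 = 0\<close>.
\<close>

definition homog ::
  "int ^ 'n ^ 'm::finite \<Rightarrow> ('r \<Rightarrow> int ^ 'm) \<Rightarrow> ('n::finite, 'k::field) mpol ^ 'r::finite
    \<Rightarrow> ('m + 'n, 'k) mpol ^ 'r" where
  "homog W \<delta> v =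
     (\<Sum>u\<in>supp_vec v.
        y_pow (\<lambda>k. nat (top_degree W \<delta> v $ k - wdeg W \<delta> u $ k)) *s incl (monom_vec (coeff_vec v u) u))"

definition sat ::
  "int ^ 'n ^ 'm::finite \<Rightarrow> ('r \<Rightarrow> int ^ 'm) \<Rightarrow> ('m + 'n::finite, 'k::field) mpol ^ 'r::finite
    \<Rightarrow> ('m + 'n, 'k) mpol ^ 'r" where
  "sat W \<delta> U = homog W \<delta> (deh U)"

definition homog_submodule ::
  "int ^ 'n ^ 'm::finite \<Rightarrow> ('r \<Rightarrow> int ^ 'm) \<Rightarrow> (('n::finite, 'k::field) mpol ^ 'r::finite) set
    \<Rightarrow> (('m + 'n, 'k) mpol ^ 'r) set" where
  "homog_submodule W \<delta> M = free_module.span (homog W \<delta> ` M)"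

definition deh_submodule ::
  "(('m::finite + 'n::finite, 'k::field) mpol ^ 'r::finite) set \<Rightarrow> (('n, 'k) mpol ^ 'r) set" where
  "deh_submodule N = deh ` N"

definition sat_submodule ::
  "int ^ 'n ^ 'm::finite \<Rightarrow> ('r \<Rightarrow> int ^ 'm) \<Rightarrow> (('m + 'n::finite, 'k::field) mpol ^ 'r::finite) set
    \<Rightarrow> (('m + 'n, 'k) mpol ^ 'r) set" where
  "sat_submodule W \<delta> N = homog_submodule W \<delta> (deh_submodule N)"

definition colon_y_infty ::
  "(('m::finite + 'n, 'k::field) mpol ^ 'r) set \<Rightarrow> (('m + 'n, 'k) mpol ^ 'r) set" where
  "colon_y_infty N = {V. \<exists>a::nat. (\<Prod>k\<in>UNIV. indet (Inl k)) ^ a *s V \<in> N}"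

end

theory Submission
  imports Defs
begin

text \<open>
  The idea behind all the parts is that a term of \<open>F\<close>-bar is determined by its degree together
  with its dehomogenization: the exponent of \<open>y\<^sub>k\<close> is the difference of the \<open>k\<close>-th
  components of the two degrees. Hence, for a fixed degree \<open>d\<close>, setting all \<open>y\<^sub>k\<close> to 1 is a
  bijection from the terms of degree \<open>d\<close> onto the terms of \<open>F\<close> of degree at most \<open>d\<close>
  (componentwise), with inverse \<open>lift_term W \<delta> d\<close>. Extending these maps linearly gives a
  homogenization into any sufficiently large degree, which is inverse to \<open>deh\<close>; the usual
  homogenization is the case of the least possible degree, and raising the degree multiplies by a
  power product in the \<open>y\<^sub>k\<close> (\<open>lift_eq_y_pow_homog\<close>). In particular a homogeneous vector is a
  power product in the \<open>y\<^sub>k\<close> times its saturation (\<open>homogeneous_eq_y_pow_sat\<close>).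

  Within one degree the bijection transports \<open>\<sigma>\<close> to its extension, so the leading terms of \<open>U\<close>
  and of its saturation are the lifts of the leading term of \<open>deh U\<close> to two different degrees
  (\<open>LT_lift\<close>). This gives the statements about leading terms.

  For a graded submodule \<open>N\<close>, multiplying the homogeneous components of \<open>V \<in> N\<close> by power
  products in the \<open>y\<^sub>k\<close> brings them all into one degree without changing \<open>deh V\<close>. Therefore
  every element of \<open>deh ` N\<close> is the dehomogenization of a homogeneous element of \<open>N\<close>, and a
  multiple of the saturation of \<open>V\<close> by a power product in the \<open>y\<^sub>k\<close> lies in \<open>N\<close>
  (\<open>graded_submodule_homogeneous_deh\<close>). The description of the saturation as a colon module, its
  homogeneous generators and its dehomogenization follow. The statement about generators
  of a submodule of \<open>F\<close> holds because \<open>deh\<close> commutes with spans and \<open>deh (homog W \<delta> v) = v\<close>.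
\<close>

section \<open>Vectors as combinations of terms\<close>

lemma coeff_vec_eqI: "coeff_vec V = coeff_vec V' \<Longrightarrow> V = V'"
  by (auto simp: coeff_vec_def vec_eq_iff fun_eq_iff intro!: poly_mapping_eqI)

lemma coeff_vec_zero [simp]: "coeff_vec 0 u = 0"
  by (simp add: coeff_vec_def split: prod.splits)

lemma coeff_vec_add: "coeff_vec (V + V') u = coeff_vec V u + coeff_vec V' u"
  by (simp add: coeff_vec_def lookup_add split: prod.splits)

lemma coeff_vec_sum: "coeff_vec (sum f A) u = (\<Sum>a\<in>A. coeff_vec (f a) u)"
  by (induction A rule: infinite_finite_induct) (simp_all add: coeff_vec_add)

lemma coeff_monom_vec: "coeff_vec (monom_vec c w) u = (if u = w then c else 0)"
  by (auto simp: coeff_vec_def monom_vec_def axis_def lookup_single when_def split: prod.splits)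

lemma monom_vec_zero [simp]: "monom_vec 0 u = 0"
  by (rule coeff_vec_eqI) (simp add: fun_eq_iff coeff_monom_vec)

lemma monom_vec_add: "monom_vec (c + d) u = monom_vec c u + monom_vec d u"
  by (rule coeff_vec_eqI) (simp add: fun_eq_iff coeff_monom_vec coeff_vec_add)

lemma monom_vec_eq_iff: "c \<noteq> 0 \<Longrightarrow> monom_vec c u = monom_vec c w \<longleftrightarrow> u = w"
  by (metis coeff_monom_vec)

lemma supp_monom_vec: "c \<noteq> 0 \<Longrightarrow> supp_vec (monom_vec c u) = {u}"
  by (auto simp: supp_vec_def coeff_monom_vec)

lemma supp_zero [simp]: "supp_vec 0 = {}"
  by (simp add: supp_vec_def)

lemma finite_supp_vec [simp]: "finite (supp_vec V)"
proof -
  have "supp_vec V \<subseteq> (\<Union>i. (\<lambda>t. (t, i)) ` Poly_Mapping.keys (V $ i))"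
    by (auto simp: supp_vec_def coeff_vec_def in_keys_iff image_iff)
  then show ?thesis
    by (rule finite_subset) simp
qed

lemma not_in_supp_vec: "u \<notin> supp_vec V \<longleftrightarrow> coeff_vec V u = 0"
  by (simp add: supp_vec_def)

lemma sum_monom_vec: "(\<Sum>u\<in>supp_vec V. monom_vec (coeff_vec V u) u) = V"
  by (rule coeff_vec_eqI) (simp add: fun_eq_iff coeff_vec_sum coeff_monom_vec not_in_supp_vec)

lemma supp_eq_empty_iff: "supp_vec V = {} \<longleftrightarrow> V = 0"
proof
  assume "supp_vec V = {}"
  then have "(\<Sum>u\<in>supp_vec V. monom_vec (coeff_vec V u) u) = 0" by simp
  then show "V = 0" unfolding sum_monom_vec .
qed simp

lemma vec_induct [case_names zero add monom]:
  assumes "Q 0" and "\<And>V V'. Q V \<Longrightarrow> Q V' \<Longrightarrow> Q (V + V')" and "\<And>c u. Q (monom_vec c u)"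
  shows "Q V"
proof -
  have "Q (\<Sum>u\<in>A. monom_vec (coeff_vec V u) u)" if "finite A" for A
    using that by induction (simp_all add: assms)
  from this[of "supp_vec V"] show ?thesis
    by (simp add: sum_monom_vec)
qed

lemma mpol_induct [case_names zero add single]:
  assumes "Q 0" and "\<And>p q. Q p \<Longrightarrow> Q q \<Longrightarrow> Q (p + q)" and "\<And>t c. Q (Poly_Mapping.single t c)"
  shows "Q (p :: ('v, 'k::field) mpol)"
proof (induction p rule: update_induct)
  case const
  then show ?case by (rule assms(1))
next
  case (update f a b)
  have "Poly_Mapping.update a b f = f + Poly_Mapping.single a b"
    using update(1) by (auto intro!: poly_mapping_eqI simp: lookup_update lookup_add lookup_single
        when_def in_keys_iff)
  then show ?case
    using update by (simp add: assms)
qed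

lemma single_scale_monom_vec:
  "Poly_Mapping.single t c *s monom_vec d (s, i) = monom_vec (c * d) (t + s, i)"
  by (simp add: monom_vec_def vec_eq_iff axis_def mult_single)


section \<open>Linear extensions of maps on terms\<close>

text \<open>
  Dehomogenization, the embedding of \<open>F\<close>, homogenization and multiplication by a power product in
  the \<open>y\<^sub>k\<close> all send terms to terms and keep the coefficients. Treating them as instances of one
  construction reduces identities between them to identities between maps on terms.
\<close>

definition map_terms ::
  "(('v, 'r) mterm \<Rightarrow> ('w, 'r) mterm) \<Rightarrow> ('v, 'k::field) mpol ^ 'r::finite \<Rightarrow> ('w, 'k) mpol ^ 'r" where
  "map_terms \<phi> V = (\<Sum>u\<in>supp_vec V. monom_vec (coeff_vec V u) (\<phi> u))"

lemma map_terms_superset: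
  assumes "finite A" "supp_vec V \<subseteq> A"
  shows "map_terms \<phi> V = (\<Sum>u\<in>A. monom_vec (coeff_vec V u) (\<phi> u))"
  unfolding map_terms_def using assms by (intro sum.mono_neutral_left) (auto simp: supp_vec_def)

lemma map_terms_zero [simp]: "map_terms \<phi> 0 = 0"
  by (simp add: map_terms_def)

lemma map_terms_add: "map_terms \<phi> (V + V') = map_terms \<phi> V + map_terms \<phi> V'"
proof -
  let ?A = "supp_vec V \<union> supp_vec V'"
  have "supp_vec (V + V') \<subseteq> ?A"
    by (auto simp: supp_vec_def coeff_vec_add)
  then show ?thesis
    by (simp add: map_terms_superset[of ?A] coeff_vec_add monom_vec_add sum.distrib)
qed

lemma map_terms_sum: "map_terms \<phi> (sum f A) = (\<Sum>a\<in>A. map_terms \<phi> (f a))"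
  by (induction A rule: infinite_finite_induct) (simp_all add: map_terms_add)

lemma map_terms_monom: "map_terms \<phi> (monom_vec c u) = monom_vec c (\<phi> u)"
  by (cases "c = 0") (simp_all add: map_terms_def supp_monom_vec coeff_monom_vec)

lemma map_terms_comp: "map_terms \<phi> (map_terms \<psi> V) = map_terms (\<phi> \<circ> \<psi>) V"
  by (induction V rule: vec_induct) (simp_all add: map_terms_add map_terms_monom)

lemma map_terms_cong:
  "(\<And>u. u \<in> supp_vec V \<Longrightarrow> \<phi> u = \<psi> u) \<Longrightarrow> map_terms \<phi> V = map_terms \<psi> V"
  by (simp add: map_terms_def)

lemma map_terms_ident:
  "(\<And>u. u \<in> supp_vec V \<Longrightarrow> \<phi> u = u) \<Longrightarrow> map_terms \<phi> V = V"
  by (simp add: map_terms_def sum_monom_vec)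

lemma supp_map_terms_subset: "supp_vec (map_terms \<phi> V) \<subseteq> \<phi> ` supp_vec V"
proof
  fix u assume "u \<in> supp_vec (map_terms \<phi> V)"
  then have "(\<Sum>w\<in>supp_vec V. coeff_vec (monom_vec (coeff_vec V w) (\<phi> w)) u) \<noteq> 0"
    by (simp add: supp_vec_def map_terms_def coeff_vec_sum)
  then obtain w where "w \<in> supp_vec V" "coeff_vec (monom_vec (coeff_vec V w) (\<phi> w)) u \<noteq> 0"
    by (rule sum.not_neutral_contains_not_neutral)
  then show "u \<in> \<phi> ` supp_vec V"
    by (auto simp: coeff_monom_vec split: if_splits)
qed

text \<open>
  The bridge to the substitution homomorphisms, which act on each component separately.
\<close>

lemma map_terms_nth:
  assumes "\<And>t i. \<phi> (t, i) = (g t, i)"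
  shows "map_terms \<phi> V $ i =
    (\<Sum>t\<in>Poly_Mapping.keys (V $ i). Poly_Mapping.single (g t) (Poly_Mapping.lookup (V $ i) t))"
proof (induction V rule: vec_induct)
  case zero
  show ?case by simp
next
  case (add V V')
  let ?A = "Poly_Mapping.keys (V $ i) \<union> Poly_Mapping.keys (V' $ i)"
  let ?f = "\<lambda>X t. Poly_Mapping.single (g t) (Poly_Mapping.lookup (X $ i) t)"
  have *: "sum (?f X) (Poly_Mapping.keys (X $ i)) = sum (?f X) ?A"
    if "Poly_Mapping.keys (X $ i) \<subseteq> ?A" for X
    using that by (intro sum.mono_neutral_left) (auto simp: in_keys_iff)
  have "Poly_Mapping.keys ((V + V') $ i) \<subseteq> ?A"
    by (simp add: Poly_Mapping.keys_add)
  then show ?case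
    using add by (simp add: * map_terms_add lookup_add single_add sum.distrib del: vector_add_component)
      (simp add: lookup_add single_add sum.distrib)
next
  case (monom c u)
  obtain t j where "u = (t, j)" by (cases u)
  then have "map_terms \<phi> (monom_vec c u) = monom_vec c (g t, j)"
    by (simp add: map_terms_monom assms)
  then show ?case
    using \<open>u = (t, j)\<close> by (simp add: monom_vec_def axis_def)
qed


section \<open>Homogenization and dehomogenization on terms\<close>

definition pp_join :: "('m::finite \<Rightarrow> nat) \<Rightarrow> 'n::finite pp \<Rightarrow> ('m + 'n) pp" where
  "pp_join a t = Abs_poly_mapping (case_sum a (Poly_Mapping.lookup t))"

lemma lookup_pp_join [simp]:
  "Poly_Mapping.lookup (pp_join a t) (Inl k) = a k"
  "Poly_Mapping.lookup (pp_join a t) (Inr j) = Poly_Mapping.lookup t j"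
  by (simp_all add: pp_join_def)

lemma lookup_map_key_Inr [simp]:
  "Poly_Mapping.lookup (Poly_Mapping.map_key Inr t) j = Poly_Mapping.lookup t (Inr j)"
  by (simp add: map_key.rep_eq)

lemma pp_sum_eqI:
  fixes s t :: "('m::finite + 'n::finite) pp"
  assumes "\<And>k. Poly_Mapping.lookup s (Inl k) = Poly_Mapping.lookup t (Inl k)"
    and "\<And>j. Poly_Mapping.lookup s (Inr j) = Poly_Mapping.lookup t (Inr j)"
  shows "s = t"
  using assms by (metis poly_mapping_eqI sum.exhaust)

definition incl_term :: "('n::finite, 'r) mterm \<Rightarrow> ('m::finite + 'n, 'r) mterm" where
  "incl_term = (\<lambda>(t, i). (pp_join (\<lambda>_. 0) t, i))"

text \<open>
  Multiplication of a term by \<open>y_pow a\<close>.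
\<close>

definition y_shift :: "('m::finite \<Rightarrow> nat) \<Rightarrow> ('m + 'n::finite, 'r) mterm \<Rightarrow> ('m + 'n, 'r) mterm" where
  "y_shift a = (\<lambda>(t, i). (pp_join a 0 + t, i))"

text \<open>
  The only term of degree \<open>d\<close> whose dehomogenization is \<open>w\<close>. The truncation by \<open>nat\<close> is harmless
  as long as the degree of \<open>w\<close> is at most \<open>d\<close> in each component; otherwise no such term exists.
\<close>

definition lift_term ::
  "int ^ 'n ^ 'm::finite \<Rightarrow> ('r \<Rightarrow> int ^ 'm) \<Rightarrow> int ^ 'm \<Rightarrow> ('n::finite, 'r) mterm
    \<Rightarrow> ('m + 'n, 'r) mterm" where
  "lift_term W \<delta> d w = y_shift (\<lambda>k. nat (d $ k - wdeg W \<delta> w $ k)) (incl_term w)"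

lemma indet_power: "indet x ^ n = (Poly_Mapping.single (Poly_Mapping.single x n) 1 :: ('v, 'k::field) mpol)"
  by (induction n) (simp_all add: indet_def mult_single single_add[symmetric])

lemma prod_single:
  "(\<Prod>x\<in>A. Poly_Mapping.single (f x) 1) = (Poly_Mapping.single (\<Sum>x\<in>A. f x) 1 :: ('v, 'k::field) mpol)"
  by (induction A rule: infinite_finite_induct) (simp_all add: mult_single)

lemma pp_join_eq_sum:
  "pp_join a t = (\<Sum>k\<in>UNIV. Poly_Mapping.single (Inl k) (a k))
     + (\<Sum>j\<in>UNIV. Poly_Mapping.single (Inr j) (Poly_Mapping.lookup t j))"
  by (rule pp_sum_eqI) (simp_all add: lookup_add lookup_sum lookup_single when_def)

lemma y_pow_eq: "y_pow a = Poly_Mapping.single (pp_join a 0) 1"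
  by (simp add: y_pow_def indet_power prod_single pp_join_eq_sum)

lemma prod_indet_power: "(\<Prod>k\<in>UNIV. indet (Inl k)) ^ a = y_pow (\<lambda>_. a)"
  by (simp add: y_pow_def prod_power_distrib)

lemma subst_mpol_incl:
  "subst_mpol (\<lambda>j. indet (Inr j)) p =
     (\<Sum>t\<in>Poly_Mapping.keys p.
        Poly_Mapping.single (pp_join (\<lambda>_. 0) t :: ('m::finite + 'n::finite) pp) (Poly_Mapping.lookup p t))"
  by (simp add: subst_mpol_def indet_power prod_single mult_single pp_join_eq_sum)

lemma subst_mpol_deh:
  "subst_mpol (case_sum (\<lambda>k. 1) indet) p =
     (\<Sum>t\<in>Poly_Mapping.keys p.
        Poly_Mapping.single (Poly_Mapping.map_key Inr t) (Poly_Mapping.lookup (p :: ('m::finite + 'n::finite, 'k::field) mpol) t))"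
proof -
  have *: "(\<Sum>j\<in>UNIV. Poly_Mapping.single j (Poly_Mapping.lookup t (Inr j))) = Poly_Mapping.map_key Inr t"
    for t :: "('m + 'n) pp"
    by (rule poly_mapping_eqI) (simp add: lookup_sum lookup_single when_def)
  have "(\<Prod>x\<in>UNIV. case_sum (\<lambda>k. 1) indet x ^ Poly_Mapping.lookup t x)
      = (Poly_Mapping.single (Poly_Mapping.map_key Inr t) 1 :: ('n, 'k) mpol)" for t :: "('m + 'n) pp"
    unfolding UNIV_Plus_UNIV[symmetric]
    by (subst prod.Plus) (simp_all add: indet_power prod_single *)
  then show ?thesis
    by (simp add: subst_mpol_def mult_single)
qed

lemma deh_eq_map_terms: "deh V = map_terms deh_term V"
  by (simp add: vec_eq_iff deh_def subst_mpol_deh deh_term_def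
      map_terms_nth[where g = "Poly_Mapping.map_key Inr"])

lemma incl_eq_map_terms: "incl v = map_terms incl_term v"
  by (simp add: vec_eq_iff incl_def subst_mpol_incl incl_term_def
      map_terms_nth[where g = "pp_join (\<lambda>_. 0)"])

text \<open>
  A power product in the \<open>y\<^sub>k\<close> is a single monomial with coefficient 1, so multiplication by it
  shifts every term and changes no coefficient.
\<close>

lemma y_pow_scale_eq_map_terms: "y_pow a *s V = map_terms (y_shift a) V"
proof (induction V rule: vec_induct)
  case zero
  show ?case by simp
next
  case (add V V')
  then show ?case
    by (simp add: map_terms_add free_module.scale_right_distrib)
next
  case (monom c u)
  obtain t i where "u = (t, i)" by (cases u)
  then show ?case
    by (simp add: map_terms_monom y_pow_eq single_scale_monom_vec y_shift_def)
qed

lemma y_shift_y_shift [simp]: "y_shift a (y_shift b u) = y_shift (\<lambda>k. a k + b k) u"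
  by (auto simp: y_shift_def lookup_add intro!: pp_sum_eqI split: prod.splits)

lemma y_pow_add: "y_pow a * y_pow b = y_pow (\<lambda>k. a k + b k)"
  by (simp add: y_pow_def power_add prod.distrib)

lemma y_shift_eq_iff: "y_shift a u = y_shift b u \<longleftrightarrow> a = b"
proof
  assume *: "y_shift a u = y_shift b u"
  show "a = b"
  proof
    fix k
    from * show "a k = b k"
      by (auto simp: y_shift_def split: prod.splits
          dest: arg_cong[where f = "\<lambda>t. Poly_Mapping.lookup t (Inl k)"])
  qed
qed simp

lemma deh_term_y_shift [simp]: "deh_term (y_shift a u) = deh_term u"
  by (auto simp: deh_term_def y_shift_def lookup_add intro!: poly_mapping_eqI split: prod.splits)

lemma deh_term_incl_term [simp]: "deh_term (incl_term w) = w"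
  by (auto simp: deh_term_def incl_term_def intro!: poly_mapping_eqI split: prod.splits)

lemma deh_term_lift_term [simp]: "deh_term (lift_term W \<delta> d w) = w"
  by (simp add: lift_term_def)

lemma wdeg_Wbar:
  "wdeg (Wbar W) \<delta> (t, i) $ k
    = int (Poly_Mapping.lookup t (Inl k)) + wdeg W \<delta> (deh_term (t, i)) $ k"
proof -
  have "(\<Sum>x\<in>UNIV. Wbar W $ k $ x * int (Poly_Mapping.lookup t x))
     = int (Poly_Mapping.lookup t (Inl k)) + (\<Sum>j\<in>UNIV. W $ k $ j * int (Poly_Mapping.lookup t (Inr j)))"
    unfolding UNIV_Plus_UNIV[symmetric]
    by (subst sum.Plus) (simp_all add: Wbar_def if_distrib[of "\<lambda>x. x * _"] cong: if_cong)
  then show ?thesis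
    by (simp add: wdeg_def deh_term_def matrix_vector_mult_def)
qed

lemma wdeg_deh_term_le: "wdeg W \<delta> (deh_term u) $ k \<le> wdeg (Wbar W) \<delta> u $ k"
  by (cases u) (simp add: wdeg_Wbar)

text \<open>
  Since \<open>y\<^sub>k\<close> contributes the \<open>k\<close>-th standard basis vector to the degree, the degree of \<open>u\<close> and
  its part in the \<open>x\<^sub>j\<close> leave no choice for the exponents of the \<open>y\<^sub>k\<close>.
\<close>

lemma lift_term_deh_term:
  assumes "wdeg (Wbar W) \<delta> u = d"
  shows "lift_term W \<delta> d (deh_term u) = u"
proof (cases u)
  case (Pair t i)
  have "int (Poly_Mapping.lookup t (Inl k)) = d $ k - wdeg W \<delta> (deh_term (t, i)) $ k" for k
    using assms Pair wdeg_Wbar[of W \<delta> t i k] by simp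
  then have "nat (d $ k - wdeg W \<delta> (deh_term (t, i)) $ k) = Poly_Mapping.lookup t (Inl k)" for k
    by (metis nat_int)
  then show ?thesis
    unfolding Pair lift_term_def y_shift_def incl_term_def
    by (auto simp: deh_term_def lookup_add intro!: pp_sum_eqI split: prod.splits)
qed

lemma wdeg_lift_term:
  assumes "wdeg W \<delta> w \<le> d"
  shows "wdeg (Wbar W) \<delta> (lift_term W \<delta> d w) = d"
proof -
  obtain t i where w: "w = (t, i)" by (cases w)
  have le: "wdeg W \<delta> (t, i) $ k \<le> d $ k" for k
    using assms w by (simp add: less_eq_vec_def)
  show ?thesis
  proof (rule vec_eq_iff[THEN iffD2], rule allI)
    fix k
    have "lift_term W \<delta> d w = (pp_join (\<lambda>k. nat (d $ k - wdeg W \<delta> w $ k)) 0 + pp_join (\<lambda>_. 0) t, i)"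
      by (simp add: lift_term_def y_shift_def incl_term_def w)
    then show "wdeg (Wbar W) \<delta> (lift_term W \<delta> d w) $ k = d $ k"
      using deh_term_lift_term[of W \<delta> d w] le[of k]
      by (simp add: wdeg_Wbar lookup_add w)
  qed
qed

lemma y_shift_lift_term:
  assumes "wdeg W \<delta> w \<le> e" "e \<le> d"
  shows "y_shift (\<lambda>k. nat (d $ k - e $ k)) (lift_term W \<delta> e w) = lift_term W \<delta> d w"
proof -
  have "nat (d $ k - e $ k) + nat (e $ k - wdeg W \<delta> w $ k) = nat (d $ k - wdeg W \<delta> w $ k)" for k
    using assms by (simp add: less_eq_vec_def nat_add_distrib[symmetric])
  then show ?thesis
    by (simp add: lift_term_def)
qed


section \<open>Homogenization in a given degree\<close>

lemma deh_y_pow: "deh (y_pow a *s V) = deh V"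
  by (simp add: deh_eq_map_terms y_pow_scale_eq_map_terms map_terms_comp comp_def)

lemma deh_lift: "deh (map_terms (lift_term W \<delta> d) v) = v"
  by (simp add: deh_eq_map_terms map_terms_comp comp_def map_terms_ident)

lemma homog_eq_lift: "homog W \<delta> v = map_terms (lift_term W \<delta> (top_degree W \<delta> v)) v"
  unfolding homog_def map_terms_def[of "lift_term W \<delta> (top_degree W \<delta> v)"]
  by (simp add: y_pow_scale_eq_map_terms incl_eq_map_terms map_terms_monom lift_term_def)

lemma deh_homog [simp]: "deh (homog W \<delta> v) = v"
  by (simp add: homog_eq_lift deh_lift)

lemma wdeg_le_top_degree: "w \<in> supp_vec v \<Longrightarrow> wdeg W \<delta> w \<le> top_degree W \<delta> v"
  by (auto simp: less_eq_vec_def top_degree_def intro!: Max_ge)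

lemma top_degree_le:
  assumes "v \<noteq> 0" and "\<And>w. w \<in> supp_vec v \<Longrightarrow> wdeg W \<delta> w \<le> d"
  shows "top_degree W \<delta> v \<le> d"
proof -
  have "supp_vec v \<noteq> {}"
    using assms(1) by (simp add: supp_eq_empty_iff)
  moreover have "wdeg W \<delta> w $ k \<le> d $ k" if "w \<in> supp_vec v" for w k
    using assms(2)[OF that] by (simp add: less_eq_vec_def)
  ultimately show ?thesis
    by (simp add: less_eq_vec_def top_degree_def)
qed

text \<open>
  For \<open>v \<noteq> 0\<close> the top degree is the least degree into which \<open>v\<close> can be homogenized. Every other admissible
  degree \<open>d\<close> exceeds it componentwise, and the same excess in the exponents of the \<open>y\<^sub>k\<close> occurs in
  all terms.
\<close>

lemma lift_eq_y_pow_homog: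
  assumes "\<And>w. w \<in> supp_vec v \<Longrightarrow> wdeg W \<delta> w \<le> d"
  shows "map_terms (lift_term W \<delta> d) v
    = y_pow (\<lambda>k. nat (d $ k - top_degree W \<delta> v $ k)) *s homog W \<delta> v"
proof (cases "v = 0")
  case True
  then show ?thesis unfolding homog_eq_lift by simp
next
  case False
  then have "top_degree W \<delta> v \<le> d"
    by (rule top_degree_le) (rule assms)
  then show ?thesis
    unfolding homog_eq_lift y_pow_scale_eq_map_terms map_terms_comp
    by (intro map_terms_cong) (simp add: y_shift_lift_term wdeg_le_top_degree)
qed

lemma wdeg_supp_lift:
  assumes "\<And>w. w \<in> supp_vec v \<Longrightarrow> wdeg W \<delta> w \<le> d" and "u \<in> supp_vec (map_terms (lift_term W \<delta> d) v)"
  shows "wdeg (Wbar W) \<delta> u = d"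
proof -
  obtain w where "w \<in> supp_vec v" "u = lift_term W \<delta> d w"
    using assms(2) supp_map_terms_subset[of "lift_term W \<delta> d" v] by blast
  then show ?thesis
    using assms(1) by (simp add: wdeg_lift_term)
qed

lemma wdeg_supp_homog:
  "u \<in> supp_vec (homog W \<delta> v) \<Longrightarrow> wdeg (Wbar W) \<delta> u = top_degree W \<delta> v"
  unfolding homog_eq_lift by (rule wdeg_supp_lift) (rule wdeg_le_top_degree)

text \<open>
  A homogeneous vector is recovered from its dehomogenization, because each of its terms is.
\<close>

lemma lift_deh:
  assumes "\<And>u. u \<in> supp_vec V \<Longrightarrow> wdeg (Wbar W) \<delta> u = d"
  shows "map_terms (lift_term W \<delta> d) (deh V) = V"
  by (simp add: deh_eq_map_terms map_terms_comp map_terms_ident lift_term_deh_term assms)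

lemma wdeg_supp_deh_le:
  assumes "\<And>u. u \<in> supp_vec V \<Longrightarrow> wdeg (Wbar W) \<delta> u \<le> d" and "w \<in> supp_vec (deh V)"
  shows "wdeg W \<delta> w \<le> d"
proof -
  obtain u where "u \<in> supp_vec V" "w = deh_term u"
    using assms(2) supp_map_terms_subset[of deh_term V] by (auto simp: deh_eq_map_terms)
  then show ?thesis
    using assms(1)[of u] wdeg_deh_term_le[of W \<delta> u] by (auto simp: less_eq_vec_def intro: order_trans)
qed

lemma homogeneous_eq_y_pow_sat:
  assumes "\<And>u. u \<in> supp_vec V \<Longrightarrow> wdeg (Wbar W) \<delta> u = d"
  shows "V = y_pow (\<lambda>k. nat (d $ k - top_degree W \<delta> (deh V) $ k)) *s sat W \<delta> V"
proof -
  have "wdeg W \<delta> w \<le> d" if "w \<in> supp_vec (deh V)" for w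
    using wdeg_supp_deh_le[of V W \<delta> d w] that assms by simp
  then have "map_terms (lift_term W \<delta> d) (deh V)
      = y_pow (\<lambda>k. nat (d $ k - top_degree W \<delta> (deh V) $ k)) *s sat W \<delta> V"
    unfolding sat_def by (rule lift_eq_y_pow_homog)
  moreover have "map_terms (lift_term W \<delta> d) (deh V) = V"
    by (rule lift_deh) (rule assms)
  ultimately show ?thesis by metis
qed


section \<open>Leading terms\<close>

text \<open>
  Antisymmetry makes the largest element of the support unique, so that the definite description
  in \<open>LT\<close> can be evaluated.
\<close>

lemma LT_eqI:
  assumes "antisym \<sigma>" "u \<in> supp_vec V" "\<And>w. w \<in> supp_vec V \<Longrightarrow> (w, u) \<in> \<sigma>"
  shows "LT \<sigma> V = monom_vec 1 u"
proof -
  have "(THE u. u \<in> supp_vec V \<and> (\<forall>w\<in>supp_vec V. (w, u) \<in> \<sigma>)) = u"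
    using assms by (intro the_equality) (auto dest: antisymD)
  then show ?thesis by (simp add: LT_def)
qed

lemma antisym_extend_ordering:
  assumes "antisym \<sigma>"
  shows "antisym (extend_ordering W \<delta> \<sigma>)"
  by (rule antisymI)
    (auto simp: extend_ordering_def less_fun_irrefl dest: less_fun_asym antisymD[OF assms])

lemma finite_linear_order_has_max:
  assumes "linear_order \<sigma>" "finite A" "A \<noteq> {}"
  shows "\<exists>u\<in>A. \<forall>w\<in>A. (w, u) \<in> \<sigma>"
  using assms(2,3)
proof (induction rule: finite_ne_induct)
  case (singleton x)
  then show ?case
    using assms(1) by (auto simp: order_on_defs refl_on_def)
next
  case (insert x A)
  then obtain u where u: "u \<in> A" "\<forall>w\<in>A. (w, u) \<in> \<sigma>" by blast
  have "refl \<sigma>" "trans \<sigma>" "total \<sigma>"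
    using assms(1) by (auto simp: order_on_defs)
  then have "(x, u) \<in> \<sigma> \<or> (u, x) \<in> \<sigma>" "(x, x) \<in> \<sigma>"
    by (cases "x = u"; simp add: total_on_def refl_on_def)+
  then show ?case
    using u \<open>trans \<sigma>\<close> by (auto dest: transD)
qed

text \<open>
  In the support of a homogeneous vector the degrees agree, so the extended
  ordering compares its terms by \<open>\<sigma>\<close> alone; \<open>deh_term\<close> is injective there, and its inverse
  \<open>lift_term W \<delta> d\<close> takes the largest term of \<open>deh V\<close> to the largest term of \<open>V\<close>.
\<close>

lemma LT_lift:
  fixes \<sigma> :: "('n::finite, 'r::finite) mterm rel"
    and W :: "int ^ 'n ^ 'm::{finite,linorder}"
  assumes \<sigma>: "linear_order \<sigma>" and V: "\<And>u. u \<in> supp_vec V \<Longrightarrow> wdeg (Wbar W) \<delta> u = d"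
    and w: "w \<in> supp_vec (deh V)" "\<And>w'. w' \<in> supp_vec (deh V) \<Longrightarrow> (w', w) \<in> \<sigma>"
  shows "LT (extend_ordering W \<delta> \<sigma>) V = monom_vec 1 (lift_term W \<delta> d w)"
proof (rule LT_eqI)
  have anti: "antisym \<sigma>" using \<sigma> by (auto simp: order_on_defs)
  then show "antisym (extend_ordering W \<delta> \<sigma>)"
    by (rule antisym_extend_ordering)
  have supp_deh: "deh_term ` supp_vec V = supp_vec (deh V)"
  proof
    have "supp_vec V \<subseteq> lift_term W \<delta> d ` supp_vec (deh V)"
      using supp_map_terms_subset[of "lift_term W \<delta> d" "deh V"] V by (simp add: lift_deh)
    then show "deh_term ` supp_vec V \<subseteq> supp_vec (deh V)" by auto
    show "supp_vec (deh V) \<subseteq> deh_term ` supp_vec V"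
      by (simp add: deh_eq_map_terms supp_map_terms_subset)
  qed
  then obtain u where u: "u \<in> supp_vec V" "w = deh_term u"
    using w(1) by blast
  then have lift: "lift_term W \<delta> d w = u"
    using V by (simp add: lift_term_deh_term)
  then show "lift_term W \<delta> d w \<in> supp_vec V"
    using u by simp
  fix u' assume u': "u' \<in> supp_vec V"
  then have "(deh_term u', deh_term u) \<in> \<sigma>"
    using w(2) supp_deh u by blast
  moreover have "u' = u" if "deh_term u' = deh_term u"
    using that lift_term_deh_term V u(1) u' by metis
  ultimately show "(u', lift_term W \<delta> d w) \<in> extend_ordering W \<delta> \<sigma>"
    unfolding lift using V u(1) u' by (auto simp: extend_ordering_def)
qed


section \<open>Graded submodules\<close>

lemma coeff_hom_component:
  "coeff_vec (hom_component A \<delta> d V) u = (if wdeg A \<delta> u = d then coeff_vec V u else 0)"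
proof -
  have "finite {u \<in> supp_vec V. wdeg A \<delta> u = d}" by simp
  then show ?thesis
    unfolding hom_component_def
    by (auto simp: coeff_vec_sum coeff_monom_vec sum.delta) (auto simp: supp_vec_def)
qed

lemma hom_component_zero [simp]: "hom_component A \<delta> d 0 = 0"
  by (rule coeff_vec_eqI) (simp add: fun_eq_iff coeff_hom_component)

lemma hom_component_add: "hom_component A \<delta> d (V + V') = hom_component A \<delta> d V + hom_component A \<delta> d V'"
  by (rule coeff_vec_eqI) (simp add: fun_eq_iff coeff_hom_component coeff_vec_add)

lemma hom_component_monom:
  "hom_component A \<delta> d (monom_vec c u) = (if wdeg A \<delta> u = d then monom_vec c u else 0)"
  by (rule coeff_vec_eqI) (auto simp: fun_eq_iff coeff_hom_component coeff_monom_vec)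

lemma wdeg_supp_hom_component: "u \<in> supp_vec (hom_component A \<delta> d V) \<Longrightarrow> wdeg A \<delta> u = d"
  by (auto simp: supp_vec_def coeff_hom_component split: if_splits)

lemma sum_hom_component: "(\<Sum>d\<in>wdeg A \<delta> ` supp_vec V. hom_component A \<delta> d V) = V"
proof (rule coeff_vec_eqI, rule ext)
  fix u
  show "coeff_vec (\<Sum>d\<in>wdeg A \<delta> ` supp_vec V. hom_component A \<delta> d V) u = coeff_vec V u"
    using not_in_supp_vec[of u V] by (auto simp: coeff_vec_sum coeff_hom_component)
qed

lemma wdeg_y_shift: "wdeg (Wbar W) \<delta> (y_shift a u) = (\<chi> k. int (a k)) + wdeg (Wbar W) \<delta> u"
proof -
  obtain t i where u: "u = (t, i)" by (cases u)
  then have "y_shift a u = (pp_join a 0 + t, i)" by (simp add: y_shift_def)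
  moreover have "deh_term (pp_join a 0 + t, i) = deh_term (t, i)"
    using calculation u by (metis deh_term_y_shift)
  ultimately show ?thesis
    unfolding u by (simp add: vec_eq_iff wdeg_Wbar lookup_add)
qed

lemma hom_component_y_pow:
  "hom_component (Wbar W) \<delta> ((\<chi> k. int (a k)) + d) (y_pow a *s V) = y_pow a *s hom_component (Wbar W) \<delta> d V"
  unfolding y_pow_scale_eq_map_terms
  by (induction V rule: vec_induct)
    (simp_all add: map_terms_add hom_component_add map_terms_monom hom_component_monom wdeg_y_shift)

text \<open>
  The colon module is defined by powers of the product of all \<open>y\<^sub>k\<close>. Arbitrary exponents \<open>a\<close> give
  the same module, since they can be raised to their maximum.
\<close>

lemma colon_y_inftyI:
  assumes "free_module.subspace N" "y_pow a *s V \<in> N"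
  shows "V \<in> colon_y_infty N"
proof -
  define b where "b = Max (range a)"
  have "a k \<le> b" for k by (simp add: b_def)
  then have "y_pow (\<lambda>k. b - a k) *s (y_pow a *s V) = y_pow (\<lambda>_. b) *s V"
    by (simp add: y_pow_add)
  moreover have "y_pow (\<lambda>k. b - a k) *s (y_pow a *s V) \<in> N"
    using assms by (rule free_module.subspace_scale)
  ultimately have "(\<Prod>k\<in>UNIV. indet (Inl k)) ^ b *s V \<in> N"
    by (simp add: prod_indet_power)
  then show ?thesis
    by (auto simp: colon_y_infty_def)
qed

lemma colon_y_inftyE:
  assumes "V \<in> colon_y_infty N"
  obtains a where "y_pow a *s V \<in> N"
  using assms by (auto simp: colon_y_infty_def prod_indet_power)

lemma subspace_colon_y_infty:
  assumes N: "free_module.subspace N"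
  shows "free_module.subspace (colon_y_infty N)"
proof (rule free_module.subspaceI)
  show "0 \<in> colon_y_infty N"
    by (rule colon_y_inftyI[OF N, of "\<lambda>_. 0"]) (simp add: free_module.subspace_0[OF N])
next
  fix X Y assume "X \<in> colon_y_infty N" "Y \<in> colon_y_infty N"
  then obtain a b where ab: "y_pow a *s X \<in> N" "y_pow b *s Y \<in> N"
    by (metis colon_y_inftyE)
  then have "y_pow b *s (y_pow a *s X) + y_pow a *s (y_pow b *s Y) \<in> N"
    by (metis free_module.subspace_add[OF N] free_module.subspace_scale[OF N])
  also have "y_pow b *s (y_pow a *s X) + y_pow a *s (y_pow b *s Y) = y_pow (\<lambda>k. a k + b k) *s (X + Y)"
    by (simp add: y_pow_add add.commute free_module.scale_right_distrib)
  finally show "X + Y \<in> colon_y_infty N"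
    by (rule colon_y_inftyI[OF N])
next
  fix p X assume "X \<in> colon_y_infty N"
  then obtain a where "y_pow a *s X \<in> N" by (rule colon_y_inftyE)
  then have "p *s (y_pow a *s X) \<in> N" by (rule free_module.subspace_scale[OF N])
  then have "y_pow a *s (p *s X) \<in> N" by (simp add: mult.commute)
  then show "p *s X \<in> colon_y_infty N" by (rule colon_y_inftyI[OF N])
qed

lemma ex_upper_degree:
  fixes D :: "(int ^ 'm::finite) set"
  assumes "finite D"
  shows "\<exists>e. \<forall>d\<in>D. d \<le> e"
proof
  show "\<forall>d\<in>D. d \<le> (\<chi> k. Max ((\<lambda>d. d $ k) ` D))"
    using assms by (auto simp: less_eq_vec_def)
qed

text \<open>
  Homogenizing \<open>deh V\<close> in a degree \<open>e\<close> above all degrees of \<open>V\<close> multiplies the component of \<open>V\<close>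
  of degree \<open>d\<close> by the power product in the \<open>y\<^sub>k\<close> with exponents \<open>e - d\<close>. These multiples
  lie in \<open>N\<close> because \<open>N\<close> is graded.
\<close>

lemma graded_submodule_lift_deh:
  assumes "graded_submodule (Wbar W) \<delta> N" "V \<in> N"
    and e: "\<And>u. u \<in> supp_vec V \<Longrightarrow> wdeg (Wbar W) \<delta> u \<le> e"
  shows "map_terms (lift_term W \<delta> e) (deh V) \<in> N"
proof -
  have N: "free_module.subspace N" and comp: "\<And>d. hom_component (Wbar W) \<delta> d V \<in> N"
    using assms by (auto simp: graded_submodule_def)
  let ?L = "\<lambda>X. map_terms (lift_term W \<delta> e) (deh X)"
  have "?L (hom_component (Wbar W) \<delta> d V) \<in> N" if d: "d \<in> wdeg (Wbar W) \<delta> ` supp_vec V" for d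
  proof -
    let ?X = "hom_component (Wbar W) \<delta> d V"
    have "?L ?X = map_terms (y_shift (\<lambda>k. nat (e $ k - d $ k))) (map_terms (lift_term W \<delta> d) (deh ?X))"
    proof -
      have "d \<le> e" using d e by auto
      moreover have "wdeg W \<delta> w \<le> d" if "w \<in> supp_vec (deh ?X)" for w
        using that by (rule wdeg_supp_deh_le[rotated]) (simp add: wdeg_supp_hom_component)
      ultimately show ?thesis
        by (auto simp: map_terms_comp y_shift_lift_term intro!: map_terms_cong)
    qed
    also have "\<dots> = y_pow (\<lambda>k. nat (e $ k - d $ k)) *s ?X"
      by (simp add: y_pow_scale_eq_map_terms lift_deh wdeg_supp_hom_component)
    finally show ?thesis
      using comp N by (simp add: free_module.subspace_scale)
  qed
  then have "(\<Sum>d\<in>wdeg (Wbar W) \<delta> ` supp_vec V. ?L (hom_component (Wbar W) \<delta> d V)) \<in> N"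
    by (rule free_module.subspace_sum[OF N])
  also have "(\<Sum>d\<in>wdeg (Wbar W) \<delta> ` supp_vec V. ?L (hom_component (Wbar W) \<delta> d V))
     = ?L (\<Sum>d\<in>wdeg (Wbar W) \<delta> ` supp_vec V. hom_component (Wbar W) \<delta> d V)"
    by (simp add: deh_eq_map_terms map_terms_sum)
  finally show ?thesis by (simp add: sum_hom_component)
qed

text \<open>
  Passing to a common degree replaces \<open>V\<close> by a homogeneous element of \<open>N\<close> with the same
  dehomogenization, although \<open>V\<close> itself may have components in several degrees.
\<close>

lemma graded_submodule_homogeneous_deh:
  assumes "graded_submodule (Wbar W) \<delta> N" "V \<in> N"
  shows "\<exists>V'\<in>N. homogeneous (Wbar W) \<delta> V' \<and> deh V' = deh V \<and> (\<exists>a. V' = y_pow a *s sat W \<delta> V)"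
proof -
  obtain e where e: "\<And>u. u \<in> supp_vec V \<Longrightarrow> wdeg (Wbar W) \<delta> u \<le> e"
    using ex_upper_degree[of "wdeg (Wbar W) \<delta> ` supp_vec V"] by auto
  then have le: "wdeg W \<delta> w \<le> e" if "w \<in> supp_vec (deh V)" for w
    using that by (rule wdeg_supp_deh_le)
  let ?V = "map_terms (lift_term W \<delta> e) (deh V)"
  have "homogeneous (Wbar W) \<delta> ?V"
    unfolding homogeneous_def by (blast intro: wdeg_supp_lift le)
  moreover have "?V \<in> N"
    using assms e by (rule graded_submodule_lift_deh)
  moreover have "\<exists>a. ?V = y_pow a *s sat W \<delta> V"
    unfolding sat_def using lift_eq_y_pow_homog[OF le] by blast
  ultimately show ?thesis
    using deh_lift by blast
qed

text \<open>
  The generators of the saturation lie in the colon module because \<open>N\<close> contains a multiple of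
  each of them by a power product in the \<open>y\<^sub>k\<close>. Conversely, if a multiple of \<open>V\<close> by a power
  product in the \<open>y\<^sub>k\<close> lies in \<open>N\<close>, then so does the same multiple of every component of \<open>V\<close>. It
  has the same dehomogenization as the component, which is a multiple of the common saturation of
  both.
\<close>

lemma sat_submodule_eq_colon:
  assumes "graded_submodule (Wbar W) \<delta> N"
  shows "sat_submodule W \<delta> N = colon_y_infty N"
proof
  have N: "free_module.subspace N"
    using assms by (simp add: graded_submodule_def)
  have "homog W \<delta> (deh V) \<in> colon_y_infty N" if "V \<in> N" for V
    using graded_submodule_homogeneous_deh[OF assms that] colon_y_inftyI[OF N]
    by (auto simp: sat_def)
  then show "sat_submodule W \<delta> N \<subseteq> colon_y_infty N"
    unfolding sat_submodule_def homog_submodule_def deh_submodule_def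
    by (intro free_module.span_minimal subspace_colon_y_infty N) auto
next
  show "colon_y_infty N \<subseteq> sat_submodule W \<delta> N"
  proof
    fix V assume "V \<in> colon_y_infty N"
    then obtain a where a: "y_pow a *s V \<in> N" by (rule colon_y_inftyE)
    have "hom_component (Wbar W) \<delta> d V \<in> sat_submodule W \<delta> N" for d
    proof -
      let ?X = "hom_component (Wbar W) \<delta> d V"
      have "y_pow a *s ?X \<in> N"
        using assms a unfolding graded_submodule_def hom_component_y_pow[symmetric] by blast
      then have "deh ?X \<in> deh ` N"
        by (metis deh_y_pow image_eqI)
      then have "sat W \<delta> ?X \<in> sat_submodule W \<delta> N"
        unfolding sat_submodule_def homog_submodule_def deh_submodule_def sat_def
        by (blast intro: free_module.span_base)
      then have *: "y_pow b *s sat W \<delta> ?X \<in> sat_submodule W \<delta> N" for b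
        unfolding sat_submodule_def homog_submodule_def by (rule free_module.span_scale)
      show ?thesis
        by (subst homogeneous_eq_y_pow_sat[of ?X W \<delta> d]) (simp add: wdeg_supp_hom_component, rule *)
    qed
    then have "(\<Sum>d\<in>wdeg (Wbar W) \<delta> ` supp_vec V. hom_component (Wbar W) \<delta> d V) \<in> sat_submodule W \<delta> N"
      unfolding sat_submodule_def homog_submodule_def by (intro free_module.span_sum)
    then show "V \<in> sat_submodule W \<delta> N"
      by (simp add: sum_hom_component)
  qed
qed

lemma sat_submodule_eq_span_homogeneous:
  assumes "graded_submodule (Wbar W) \<delta> N"
  shows "sat_submodule W \<delta> N = free_module.span {sat W \<delta> V | V. V \<in> N \<and> homogeneous (Wbar W) \<delta> V}"
proof -
  have "homog W \<delta> ` deh ` N = {sat W \<delta> V | V. V \<in> N \<and> homogeneous (Wbar W) \<delta> V}"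
  proof
    show "homog W \<delta> ` deh ` N \<subseteq> {sat W \<delta> V | V. V \<in> N \<and> homogeneous (Wbar W) \<delta> V}"
    proof clarify
      fix V assume "V \<in> N"
      then obtain V' where "V' \<in> N" "homogeneous (Wbar W) \<delta> V'" "deh V' = deh V"
        using graded_submodule_homogeneous_deh[OF assms] by blast
      then show "\<exists>V'. homog W \<delta> (deh V) = sat W \<delta> V' \<and> V' \<in> N \<and> homogeneous (Wbar W) \<delta> V'"
        unfolding sat_def by metis
    qed
  qed (auto simp: sat_def)
  then show ?thesis
    by (simp add: sat_submodule_def homog_submodule_def deh_submodule_def)
qed

text \<open>
  A power product in the \<open>y\<^sub>k\<close> becomes 1 under \<open>deh\<close>, so passing to the colon module does not
  enlarge the dehomogenization.
\<close>

lemma deh_sat_submodule: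
  assumes "graded_submodule (Wbar W) \<delta> N"
  shows "deh_submodule (sat_submodule W \<delta> N) = deh_submodule N"
proof
  show "deh_submodule (sat_submodule W \<delta> N) \<subseteq> deh_submodule N"
    unfolding sat_submodule_eq_colon[OF assms] deh_submodule_def
    by (auto elim!: colon_y_inftyE) (metis deh_y_pow image_eqI)
  show "deh_submodule N \<subseteq> deh_submodule (sat_submodule W \<delta> N)"
  proof
    fix w assume "w \<in> deh_submodule N"
    then have "homog W \<delta> w \<in> sat_submodule W \<delta> N"
      unfolding sat_submodule_def homog_submodule_def by (blast intro: free_module.span_base)
    then show "w \<in> deh_submodule (sat_submodule W \<delta> N)"
      unfolding deh_submodule_def by (metis deh_homog image_eqI)
  qed
qed


section \<open>Dehomogenization of generators\<close>

lemma deh_add: "deh (V + V') = deh V + deh V'"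
  by (simp add: deh_eq_map_terms map_terms_add)

lemma deh_single_scale:
  "deh (Poly_Mapping.single t c *s V) = Poly_Mapping.single (Poly_Mapping.map_key Inr t) c *s deh V"
proof (induction V rule: vec_induct)
  case zero
  show ?case by (simp add: deh_eq_map_terms)
next
  case (add V V')
  then show ?case
    by (simp add: deh_add free_module.scale_right_distrib)
next
  case (monom d u)
  obtain s i where "u = (s, i)" by (cases u)
  moreover have "Poly_Mapping.map_key Inr (t + s) = Poly_Mapping.map_key Inr t + Poly_Mapping.map_key Inr s"
    by (rule poly_mapping_eqI) (simp add: lookup_add)
  ultimately show ?case
    by (simp add: single_scale_monom_vec deh_eq_map_terms map_terms_monom deh_term_def)
qed

text \<open>
  Together with the next lemma: \<open>deh\<close> is semilinear along a surjective map of the coefficient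
  rings. Only the existence of matching scalars is needed for spans.
\<close>

lemma deh_scale: "\<exists>q. \<forall>V :: ('m::finite + 'n::finite, 'k::field) mpol ^ 'r::finite. deh (p *s V) = q *s deh V"
proof (induction p rule: mpol_induct)
  case zero
  show ?case by (rule exI[of _ 0]) (simp add: deh_eq_map_terms)
next
  case (add p p')
  then obtain q q' where
    "\<forall>V :: ('m + 'n, 'k) mpol ^ 'r. deh (p *s V) = q *s deh V"
    "\<forall>V :: ('m + 'n, 'k) mpol ^ 'r. deh (p' *s V) = q' *s deh V"
    by blast
  then show ?case
    by (intro exI[of _ "q + q'"]) (simp add: deh_add free_module.scale_left_distrib)
next
  case (single t c)
  show ?case using deh_single_scale by blast
qed

lemma scale_deh:
  "\<exists>p. \<forall>V :: ('m::finite + 'n::finite, 'k::field) mpol ^ 'r::finite. q *s deh V = deh (p *s V)"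
proof (induction q rule: mpol_induct)
  case zero
  show ?case by (rule exI[of _ 0]) (simp add: deh_eq_map_terms)
next
  case (add q q')
  then obtain p p' where
    "\<forall>V :: ('m + 'n, 'k) mpol ^ 'r. q *s deh V = deh (p *s V)"
    "\<forall>V :: ('m + 'n, 'k) mpol ^ 'r. q' *s deh V = deh (p' *s V)"
    by blast
  then show ?case
    by (intro exI[of _ "p + p'"]) (simp add: deh_add free_module.scale_left_distrib)
next
  case (single t c)
  have "Poly_Mapping.map_key Inr (pp_join (\<lambda>_. 0) t :: ('m + 'n) pp) = t"
    by (rule poly_mapping_eqI) simp
  then show ?case using deh_single_scale[of "pp_join (\<lambda>_. 0) t" c] by metis
qed

lemma deh_span:
  fixes S :: "(('m::finite + 'n::finite, 'k::field) mpol ^ 'r::finite) set"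
  shows "deh ` free_module.span S = free_module.span (deh ` S)"
proof
  let ?D = "{V :: ('m + 'n, 'k) mpol ^ 'r. deh V \<in> free_module.span (deh ` S)}"
  have "free_module.subspace ?D"
  proof (rule free_module.subspaceI)
    show "0 \<in> ?D"
      by (simp add: deh_eq_map_terms free_module.span_zero)
  next
    fix p :: "('m + 'n, 'k) mpol" and X :: "('m + 'n, 'k) mpol ^ 'r" assume "X \<in> ?D"
    moreover obtain q where "deh (p *s X) = q *s deh X" using deh_scale by blast
    ultimately show "p *s X \<in> ?D"
      by (simp add: free_module.span_scale)
  qed (simp add: deh_add free_module.span_add)
  then have "free_module.span S \<subseteq> ?D"
    by (intro free_module.span_minimal) (auto intro: free_module.span_base)
  then show "deh ` free_module.span S \<subseteq> free_module.span (deh ` S)" by auto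
  have "free_module.subspace (deh ` free_module.span S)"
  proof (rule free_module.subspaceI)
    have "deh (0 :: ('m + 'n, 'k) mpol ^ 'r) = 0" by (simp add: deh_eq_map_terms)
    then show "0 \<in> deh ` free_module.span S"
      by (metis free_module.span_zero image_eqI)
  next
    fix x y assume "x \<in> deh ` free_module.span S" "y \<in> deh ` free_module.span S"
    then show "x + y \<in> deh ` free_module.span S"
      by (auto simp: deh_add[symmetric] intro: free_module.span_add)
  next
    fix q :: "('n, 'k) mpol" and x assume "x \<in> deh ` free_module.span S"
    then obtain X where X: "X \<in> free_module.span S" "x = deh X" by blast
    obtain p where "q *s x = deh (p *s X)" using scale_deh X(2) by blast
    then show "q *s x \<in> deh ` free_module.span S"
      using X(1) by (auto intro: free_module.span_scale)
  qed
  then show "free_module.span (deh ` S) \<subseteq> deh ` free_module.span S"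
    by (intro free_module.span_minimal) (auto intro: free_module.span_base)
qed

lemma homog_span_eq_sat:
  "homog_submodule W \<delta> (free_module.span S) = sat_submodule W \<delta> (free_module.span (homog W \<delta> ` S))"
  by (simp add: sat_submodule_def deh_submodule_def deh_span image_image)


section \<open>Leading terms of saturations and saturated submodules\<close>

theorem proposition9:
  fixes W :: "int ^ 'n::finite ^ 'm::{finite,linorder}"
    and \<delta> :: "'r::finite \<Rightarrow> int ^ 'm::{finite,linorder}"
    and \<sigma> :: "('n, 'r) mterm rel"
    and v :: "nat \<Rightarrow> ('n, 'k::field) mpol ^ 'r"
    and s :: nat
    and U :: "('m + 'n, 'k) mpol ^ 'r"
  assumes "rank (map_matrix rat_of_int W) = CARD('m)"
    and "module_ordering \<sigma>"
    and "homogeneous (Wbar W) \<delta> U"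
    and "U \<noteq> 0"
  defines "\<sigma>' \<equiv> extend_ordering W \<delta> \<sigma>"
  shows
    "(\<exists>a. LT \<sigma>' U = y_pow a *s LT \<sigma>' (sat W \<delta> U))
     \<and> ((\<exists>b. LT \<sigma>' U = y_pow b *s incl (LT \<sigma> (deh U)))
        \<and> (\<forall>a b. LT \<sigma>' U = y_pow a *s LT \<sigma>' (sat W \<delta> U)
             \<and> LT \<sigma>' U = y_pow b *s incl (LT \<sigma> (deh U))
             \<longrightarrow> (\<forall>k. a k \<le> b k)))
     \<and> sat W \<delta> (LT \<sigma>' U) = incl (LT \<sigma> (deh U))
     \<and> (\<forall>N :: (('m + 'n, 'k) mpol ^ 'r) set. graded_submodule (Wbar W) \<delta> N \<longrightarrow>
           sat_submodule W \<delta> N = colon_y_infty N)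
     \<and> (\<forall>N :: (('m + 'n, 'k) mpol ^ 'r) set. graded_submodule (Wbar W) \<delta> N \<longrightarrow>
           sat_submodule W \<delta> N = free_module.span {sat W \<delta> V | V. V \<in> N \<and> homogeneous (Wbar W) \<delta> V})
     \<and> (\<forall>N :: (('m + 'n, 'k) mpol ^ 'r) set. graded_submodule (Wbar W) \<delta> N \<longrightarrow>
           deh_submodule (sat_submodule W \<delta> N) = deh_submodule N)
     \<and> homog_submodule W \<delta> (free_module.span (v ` {1..s})) =
         sat_submodule W \<delta> (free_module.span ((\<lambda>i. homog W \<delta> (v i)) ` {1..s}))"
proof -
  obtain d where d: "\<And>u. u \<in> supp_vec U \<Longrightarrow> wdeg (Wbar W) \<delta> u = d"
    using assms(3) by (auto simp: homogeneous_def)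
  define \<mu> where "\<mu> = top_degree W \<delta> (deh U)"
  have lin: "linear_order \<sigma>"
    using assms(2) by (simp add: module_ordering_def)
  have "deh U \<noteq> 0"
    using lift_deh[of U W \<delta> d] d assms(4) by auto
  then obtain w where w: "w \<in> supp_vec (deh U)" "\<And>w'. w' \<in> supp_vec (deh U) \<Longrightarrow> (w', w) \<in> \<sigma>"
    using finite_linear_order_has_max[OF lin finite_supp_vec, of "deh U"]
    by (auto simp: supp_eq_empty_iff)
  \<comment> \<open>\<open>U\<close> and its saturation are the lifts of \<open>deh U\<close> to the degrees \<open>d\<close> and \<open>\<mu>\<close>, hence
      \<open>\<mu> \<le> d\<close>, and their leading terms are the lifts of \<open>w\<close>.\<close>
  have wdeg_w: "wdeg W \<delta> w \<le> \<mu>"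
    unfolding \<mu>_def by (rule wdeg_le_top_degree) (rule w(1))
  have "wdeg W \<delta> w' \<le> d" if "w' \<in> supp_vec (deh U)" for w'
    using that by (rule wdeg_supp_deh_le[rotated]) (simp add: d)
  then have \<mu>_le: "\<mu> \<le> d"
    unfolding \<mu>_def using top_degree_le \<open>deh U \<noteq> 0\<close> by blast
  have LT_deh: "LT \<sigma> (deh U) = monom_vec 1 w"
    using lin w by (intro LT_eqI) (auto simp: order_on_defs)
  have LT_U: "LT \<sigma>' U = monom_vec 1 (lift_term W \<delta> d w)"
    unfolding \<sigma>'_def using lin d w by (rule LT_lift)
  have LT_sat: "LT \<sigma>' (sat W \<delta> U) = monom_vec 1 (lift_term W \<delta> \<mu> w)"
    unfolding \<sigma>'_def sat_def \<mu>_def using lin wdeg_supp_homog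
    by (rule LT_lift) (simp_all add: w)
  have incl_LT: "incl (LT \<sigma> (deh U)) = monom_vec 1 (incl_term w)"
    by (simp add: LT_deh incl_eq_map_terms map_terms_monom)

  have 1: "\<exists>a. LT \<sigma>' U = y_pow a *s LT \<sigma>' (sat W \<delta> U)"
    by (rule exI[of _ "\<lambda>k. nat (d $ k - \<mu> $ k)"])
      (simp add: LT_U LT_sat y_pow_scale_eq_map_terms map_terms_monom y_shift_lift_term wdeg_w \<mu>_le)
  have 2: "\<exists>b. LT \<sigma>' U = y_pow b *s incl (LT \<sigma> (deh U))"
    by (rule exI[of _ "\<lambda>k. nat (d $ k - wdeg W \<delta> w $ k)"])
      (simp add: LT_U incl_LT y_pow_scale_eq_map_terms map_terms_monom lift_term_def)
  have 3: "\<forall>k. a k \<le> b k"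
    if "LT \<sigma>' U = y_pow a *s LT \<sigma>' (sat W \<delta> U)" "LT \<sigma>' U = y_pow b *s incl (LT \<sigma> (deh U))" for a b
  proof -
    \<comment> \<open>The leading term of the saturation is \<open>w\<close> times the power product with exponents \<open>c\<close>, so
        \<open>b = a + c\<close>.\<close>
    define c where "c = (\<lambda>k. nat (\<mu> $ k - wdeg W \<delta> w $ k))"
    have "y_shift b (incl_term w) = y_shift a (lift_term W \<delta> \<mu> w)"
      using that unfolding LT_sat incl_LT
      by (simp add: y_pow_scale_eq_map_terms map_terms_monom monom_vec_eq_iff)
    also have "\<dots> = y_shift (\<lambda>k. a k + c k) (incl_term w)"
      by (simp add: lift_term_def c_def)
    finally show ?thesis
      by (simp add: y_shift_eq_iff)
  qed
  have 4: "sat W \<delta> (LT \<sigma>' U) = incl (LT \<sigma> (deh U))"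
  proof -
    have "deh (LT \<sigma>' U) = monom_vec 1 w"
      by (simp add: LT_U deh_eq_map_terms map_terms_monom)
    moreover have "top_degree W \<delta> (monom_vec (1::'k) w) = wdeg W \<delta> w"
      by (simp add: top_degree_def supp_monom_vec vec_eq_iff)
    moreover have "y_shift (\<lambda>k. 0) (incl_term w) = (incl_term w :: ('m + 'n, 'r) mterm)"
      by (auto simp: y_shift_def lookup_add intro!: pp_sum_eqI split: prod.splits)
    ultimately show ?thesis
      by (simp add: sat_def homog_eq_lift map_terms_monom incl_LT lift_term_def)
  qed
  have 7: "homog_submodule W \<delta> (free_module.span (v ` {1..s})) =
      sat_submodule W \<delta> (free_module.span ((\<lambda>i. homog W \<delta> (v i)) ` {1..s}))"
    by (simp add: homog_span_eq_sat image_image)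
  show ?thesis
    using 1 2 3 4 7 sat_submodule_eq_colon[of W \<delta>] sat_submodule_eq_span_homogeneous[of W \<delta>]
      deh_sat_submodule[of W \<delta>] by blast
qed

end
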